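(* Let $a,b,c,\tau_0,\dots,\tau_4\in\mathbb{C}$ and let $W=\tau_1XY+\tau_2YX+\tau_3X+\tau_4Y+\tau_0\mathcal{I}$ be the big q-Heun operator. Then $W$ is tridiagonal in the q-Pochhammer basis $\varphi_n(x)=(x;q)_n$: for every integer $n\ge 0$, $W\varphi_n(x)$ is a linear combination, with coefficients independent of $x$, of $\varphi_{n+1}(x),\varphi_n(x),\varphi_{n-1}(x)$ (where $\varphi_{-1}:=0$).
   Context: $q\in\mathbb{C}$ is nonzero and not a root of unity. $T^{+}f(x)=f(qx)$, $T^{-}f(x)=f(x/q)$, and $\mathcal{I}$ is the identity operator. $(x;q)_n=(1-x)(1-qx)\cdots(1-q^{n-1}x)$, with $(x;q)_0=1$. $X$ is multiplication by $x$, and $$Y=B(x)T^{+}+D(x)T^{-}-(B(x)+D(x))\mathcal{I},\quad B(x)=aq\,x^{-2}(x-1)(bx-c),\quad D(x)=x^{-2}(x-aq)(x-cq)$$ is the q-difference operator of the big q-Jacobi polynomials. *)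

theory Defs
  imports Complex_Main
begin

definition qpoch :: "complex \<Rightarrow> complex \<Rightarrow> nat \<Rightarrow> complex" where
  "qpoch x q n = (\<Prod>k<n. (1 - q ^ k * x))"

text \<open>The index is an integer, so that the convention \<open>qphi q (-1) = 0\<close> is part of the definition.\<close>

definition qphi :: "complex \<Rightarrow> int \<Rightarrow> complex \<Rightarrow> complex" where
  "qphi q n = (\<lambda>x. if n < 0 then 0 else qpoch x q (nat n))"

text \<open>
  The operators act on functions on the punctured plane, since the coefficients of \<open>opY\<close> have a
  pole at \<open>0\<close>. They are represented on total functions; values at \<open>0\<close> carry no meaning, as
  \<open>x / 0 = 0\<close>. For nonzero \<open>q\<close> and \<open>x \<noteq> 0\<close>, the operators use only values of
  their argument at nonzero points.
\<close>

type_synonym func_op = "(complex \<Rightarrow> complex) \<Rightarrow> (complex \<Rightarrow> complex)"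

definition Tplus :: "complex \<Rightarrow> func_op" where
  "Tplus q f = (\<lambda>x. f (q * x))"

definition Tminus :: "complex \<Rightarrow> func_op" where
  "Tminus q f = (\<lambda>x. f (x / q))"

definition opX :: func_op where
  "opX f = (\<lambda>x. x * f x)"

definition coeffB :: "complex \<Rightarrow> complex \<Rightarrow> complex \<Rightarrow> complex \<Rightarrow> complex \<Rightarrow> complex" where
  "coeffB q a b c x = a * q / x\<^sup>2 * (x - 1) * (b * x - c)"

definition coeffD :: "complex \<Rightarrow> complex \<Rightarrow> complex \<Rightarrow> complex \<Rightarrow> complex" where
  "coeffD q a c x = 1 / x\<^sup>2 * (x - a * q) * (x - c * q)"

definition opY :: "complex \<Rightarrow> complex \<Rightarrow> complex \<Rightarrow> complex \<Rightarrow> func_op" where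
  "opY q a b c f = (\<lambda>x. coeffB q a b c x * Tplus q f x + coeffD q a c x * Tminus q f x
                        - (coeffB q a b c x + coeffD q a c x) * f x)"

definition opW :: "complex \<Rightarrow> complex \<Rightarrow> complex \<Rightarrow> complex \<Rightarrow>
    complex \<Rightarrow> complex \<Rightarrow> complex \<Rightarrow> complex \<Rightarrow> complex \<Rightarrow> func_op" where
  "opW q a b c \<tau>0 \<tau>1 \<tau>2 \<tau>3 \<tau>4 f =
     (\<lambda>x. \<tau>1 * (opX \<circ> opY q a b c) f x + \<tau>2 * (opY q a b c \<circ> opX) f x
          + \<tau>3 * opX f x + \<tau>4 * opY q a b c f x + \<tau>0 * f x)"

end

theory Submission imports Defs begin

text \<open>
  Write \<open>\<phi> n\<close> for the Pochhammer function \<open>qphi q n\<close>. The reason for the three-term result is that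
  each of the two generators is bidiagonal in this basis, in opposite directions:
  \<open>X\<close> sends \<open>\<phi> n\<close> into the span of \<open>\<phi> n\<close> and \<open>\<phi> (n + 1)\<close> (lemma \<open>opX_qphi\<close>), because the last factor
  of \<open>\<phi> (n + 1)\<close> is \<open>1 - q ^ n * x\<close>, whereas \<open>Y\<close> sends \<open>\<phi> n\<close> into the span of \<open>\<phi> n\<close> and
  \<open>\<phi> (n - 1)\<close> (lemma \<open>opY_qphi\<close>). A product of an upper and a lower bidiagonal operator is
  tridiagonal in either order, so \<open>XY\<close> and \<open>YX\<close> are tridiagonal, and hence so is every linear
  combination \<open>W\<close>.

  The lower bidiagonality of \<open>Y\<close> is the fact behind the hypergeometric representation of
  the big q-Jacobi polynomials. Up to elementary factors, both \<open>q\<close>-shifts of \<open>\<phi> n\<close> are multiples of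
  \<open>\<phi> (n - 1)\<close>: the zero of \<open>B\<close> at \<open>x = 1\<close> supplies the missing first factor of the forward shift, and the
  backward shift only trades the last factor of \<open>\<phi> n\<close> for \<open>1 - x / q\<close>. After \<open>\<phi> (n - 1)\<close> is divided
  out, the pole of order two cancels and a polynomial of degree one is left, which is a combination of
  \<open>1\<close> and the last factor \<open>1 - q ^ (n - 1) * x\<close> of \<open>\<phi> n\<close>.
\<close>

lemma qpoch_Suc: "qpoch x q (Suc n) = (1 - q ^ n * x) * qpoch x q n"
  by (simp add: qpoch_def)

lemma qpoch_Suc_first: "qpoch x q (Suc n) = (1 - x) * qpoch (q * x) q n"
  by (simp only: qpoch_def prod.lessThan_Suc_shift) (simp add: mult_ac)

lemma qpoch_div_q:
  assumes "q \<noteq> 0"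
  shows "qpoch (x / q) q (Suc n) = (1 - x / q) * qpoch x q n"
  using assms by (simp add: qpoch_Suc_first)

text \<open>The diagonal entry: the eigenvalue of the degree-\<open>n\<close> big q-Jacobi polynomial.\<close>

definition bqj_diag :: "complex \<Rightarrow> complex \<Rightarrow> complex \<Rightarrow> nat \<Rightarrow> complex" where
  "bqj_diag q a b n = (1 - q ^ n) * (1 - a * b * q ^ (n + 1)) / q ^ n"

definition bqj_lower :: "complex \<Rightarrow> complex \<Rightarrow> complex \<Rightarrow> nat \<Rightarrow> complex" where
  "bqj_lower q a c n = - ((1 - q ^ n) * (1 - a * q ^ n) * (1 - c * q ^ n)) / q ^ n"

lemma opX_qphi:
  assumes "q \<noteq> 0"
  shows "opX (qphi q (int n)) = (\<lambda>x. (qphi q (int n) x - qphi q (int n + 1) x) / q ^ n)"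
proof
  fix x
  have "qphi q (int n + 1) x = (1 - q ^ n * x) * qphi q (int n) x"
    by (simp add: qphi_def nat_add_distrib qpoch_Suc)
  then show "opX (qphi q (int n)) x = (qphi q (int n) x - qphi q (int n + 1) x) / q ^ n"
    using assms by (simp add: opX_def field_simps)
qed

text \<open>
  The factor \<open>1 - q ^ n\<close> of the lower entry vanishes at \<open>n = 0\<close>, which is consistent
  with \<open>qphi q (-1) = 0\<close>.
\<close>

lemma opY_qphi:
  assumes q: "q \<noteq> 0" and x: "x \<noteq> 0"
  shows "opY q a b c (qphi q (int n)) x
           = bqj_diag q a b n * qphi q (int n) x + bqj_lower q a c n * qphi q (int n - 1) x"
proof (cases n)
  case 0
  then show ?thesis
    by (simp add: opY_def Tplus_def Tminus_def qphi_def qpoch_def bqj_diag_def bqj_lower_def)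
next
  case (Suc m)
  define P where "P = qpoch x q m"
  define r where "r = q ^ m"
  have r: "r \<noteq> 0" and qn: "q ^ n = q * r"
    using q by (simp_all add: r_def Suc)
  have phi: "qphi q (int n) = (\<lambda>y. qpoch y q (Suc m))" "qphi q (int n - 1) x = P"
    by (auto simp: qphi_def Suc P_def nat_add_distrib)
  have here: "qpoch x q (Suc m) = (1 - r * x) * P"
    by (simp add: qpoch_Suc P_def r_def)
  have fwd: "(x - 1) * qpoch (q * x) q (Suc m) = - ((1 - q * r * x) * (1 - r * x) * P)"
  proof -
    have "(1 - x) * qpoch (q * x) q (Suc m) = (1 - q * r * x) * (1 - r * x) * P"
      by (simp only: qpoch_Suc_first[symmetric]) (simp add: qpoch_Suc P_def r_def)
    then show ?thesis by (metis minus_diff_eq mult_minus_left)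
  qed
  have bwd: "qpoch (x / q) q (Suc m) = (1 - x / q) * P"
    using q by (simp add: qpoch_div_q P_def)
  have "opY q a b c (qphi q (int n)) x
      = (a * q * (b * x - c) * ((x - 1) * qpoch (q * x) q (Suc m))
         + (x - a * q) * (x - c * q) * qpoch (x / q) q (Suc m)
         - (a * q * (x - 1) * (b * x - c) + (x - a * q) * (x - c * q)) * qpoch x q (Suc m)) / x\<^sup>2"
    using x by (simp add: opY_def Tplus_def Tminus_def phi coeffB_def coeffD_def
        add_divide_distrib diff_divide_distrib algebra_simps)
  also have "\<dots> = (a * q * (b * x - c) * (- ((1 - q * r * x) * (1 - r * x)))
         + (x - a * q) * (x - c * q) * (1 - x / q)
         - (a * q * (x - 1) * (b * x - c) + (x - a * q) * (x - c * q)) * (1 - r * x)) / x\<^sup>2 * P"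
    unfolding fwd here bwd by (simp add: algebra_simps add_divide_distrib diff_divide_distrib)
  \<comment> \<open>The constant and linear terms of the numerator cancel, and with them the double pole.\<close>
  also have "\<dots> = (bqj_diag q a b n * (1 - r * x) + bqj_lower q a c n) * P"
  proof -
    have "(a * q * (b * x - c) * (- ((1 - q * r * x) * (1 - r * x)))
         + (x - a * q) * (x - c * q) * (1 - x / q)
         - (a * q * (x - 1) * (b * x - c) + (x - a * q) * (x - c * q)) * (1 - r * x)) / x\<^sup>2
       = bqj_diag q a b n * (1 - r * x) + bqj_lower q a c n"
      using q x r unfolding bqj_diag_def bqj_lower_def power_add qn
      by (simp add: divide_simps) (simp add: algebra_simps power2_eq_square)
    then show ?thesis by simp
  qed
  finally show ?thesis
    by (simp add: phi here algebra_simps)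
qed

lemma opX_opY_qphi:
  assumes q: "q \<noteq> 0" and x: "x \<noteq> 0"
  shows "opX (opY q a b c (qphi q (int n))) x
           = bqj_diag q a b n / q ^ n * (qphi q (int n) x - qphi q (int n + 1) x)
             + bqj_lower q a c n * q / q ^ n * (qphi q (int n - 1) x - qphi q (int n) x)"
proof -
  have X: "x * qphi q (int k) x = (qphi q (int k) x - qphi q (int k + 1) x) / q ^ k" for k
    using fun_cong[OF opX_qphi[OF q, of k], of x] by (simp add: opX_def)
  \<comment> \<open>The recurrence for \<open>X\<close> fails at index \<open>-1\<close>, where it would read \<open>0 = - q\<close>;
    for \<open>n = 0\<close> it is the vanishing lower entry that saves the identity.\<close>
  have lower: "bqj_lower q a c n * (x * qphi q (int n - 1) x)
      = bqj_lower q a c n * q / q ^ n * (qphi q (int n - 1) x - qphi q (int n) x)"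
  proof (cases n)
    case 0
    then show ?thesis by (simp add: bqj_lower_def)
  next
    case (Suc m)
    then show ?thesis using X[of m] q by (simp add: add.commute)
  qed
  have "opX (opY q a b c (qphi q (int n))) x
      = bqj_diag q a b n * (x * qphi q (int n) x) + bqj_lower q a c n * (x * qphi q (int n - 1) x)"
    by (simp add: opX_def opY_qphi[OF q x] algebra_simps)
  then show ?thesis
    unfolding lower X by simp
qed

lemma opY_opX_qphi:
  assumes q: "q \<noteq> 0" and x: "x \<noteq> 0"
  shows "opY q a b c (opX (qphi q (int n))) x
           = (bqj_diag q a b n * qphi q (int n) x + bqj_lower q a c n * qphi q (int n - 1) x
              - (bqj_diag q a b (Suc n) * qphi q (int n + 1) x
                 + bqj_lower q a c (Suc n) * qphi q (int n) x)) / q ^ n"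
proof -
  have "opY q a b c (opX (qphi q (int n))) x
      = (opY q a b c (qphi q (int n)) x - opY q a b c (qphi q (int n + 1)) x) / q ^ n"
    unfolding opX_qphi[OF q]
    by (simp add: opY_def Tplus_def Tminus_def diff_divide_distrib add_divide_distrib algebra_simps)
  then show ?thesis
    using opY_qphi[OF q x, of a b c n] opY_qphi[OF q x, of a b c "Suc n"]
    by (simp add: add.commute)
qed

theorem mainTheorem3:
  fixes q a b c \<tau>0 \<tau>1 \<tau>2 \<tau>3 \<tau>4 :: complex and n :: int
  assumes "q \<noteq> 0"
    and "\<forall>m::nat. m \<ge> 1 \<longrightarrow> q ^ m \<noteq> 1"
    and "n \<ge> 0"
  shows "\<exists>\<alpha> \<beta> \<gamma> :: complex. \<forall>x. x \<noteq> 0 \<longrightarrow>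
           opW q a b c \<tau>0 \<tau>1 \<tau>2 \<tau>3 \<tau>4 (qphi q n) x
             = \<alpha> * qphi q (n + 1) x + \<beta> * qphi q n x + \<gamma> * qphi q (n - 1) x"
proof -
  obtain k where n: "n = int k"
    using assms(3) nonneg_int_cases by blast
  let ?d = "bqj_diag q a b" and ?l = "bqj_lower q a c" and ?p = "1 / q ^ k"
  show ?thesis
  proof (rule exI[of _ "- \<tau>1 * (?d k * ?p) - \<tau>2 * (?d (Suc k) * ?p) - \<tau>3 * ?p"],
      rule exI[of _ "\<tau>1 * (?d k * ?p - ?l k * q * ?p) + \<tau>2 * ((?d k - ?l (Suc k)) * ?p)
        + \<tau>3 * ?p + \<tau>4 * ?d k + \<tau>0"],
      rule exI[of _ "\<tau>1 * (?l k * q * ?p) + \<tau>2 * (?l k * ?p) + \<tau>4 * ?l k"],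
      intro allI impI)
    fix x :: complex
    assume x: "x \<noteq> 0"
    show "opW q a b c \<tau>0 \<tau>1 \<tau>2 \<tau>3 \<tau>4 (qphi q n) x
        = (- \<tau>1 * (?d k * ?p) - \<tau>2 * (?d (Suc k) * ?p) - \<tau>3 * ?p) * qphi q (n + 1) x
          + (\<tau>1 * (?d k * ?p - ?l k * q * ?p) + \<tau>2 * ((?d k - ?l (Suc k)) * ?p)
             + \<tau>3 * ?p + \<tau>4 * ?d k + \<tau>0) * qphi q n x
          + (\<tau>1 * (?l k * q * ?p) + \<tau>2 * (?l k * ?p) + \<tau>4 * ?l k) * qphi q (n - 1) x"
      unfolding opW_def n comp_apply opX_opY_qphi[OF assms(1) x] opY_opX_qphi[OF assms(1) x]
        opY_qphi[OF assms(1) x]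
      unfolding opX_qphi[OF assms(1)]
      by (simp add: algebra_simps add_divide_distrib diff_divide_distrib)
  qed
qed

end
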